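(* Let $\varphi=\frac{\sqrt5-1}{2}$, and for every integer $d\ge1$ let $F(d)=\lim_{n\to\infty}F_n(d)$ be the asymptotic probability that the golden game $G_n(\varphi)$ is $d$-fragile. Then $$\lim_{d\to\infty}F(d)=1.$$
   Context: For an integer $n\ge 0$, consider the complete binary tree of depth $n$ (with $2^n$ leaves). A node has height $h$ if its distance to the leaves below it is $h$ (leaves have height $0$, the root has height $n$). A game of depth $n$ is an assignment of payoffs in $\{0,1\}$ to the leaves, i.e. an element of $\{0,1\}^{2^n}$. Player 2 acts at the internal nodes of odd height and Player 1 at the internal nodes of even height, each choosing a child; Player 1 wins if the payoff of the reached leaf is $1$, and Player 2 wins if it is $0$. The value of the game in $\{0,1\}$ is given by backward induction: the value of a leaf is its payoff, the value of an internal node of odd height is the minimum of the values of its two children, the value of an internal node of even height is the maximum of the values of its two children, and the value of the game is the value of the root. Player 1 wins the game if its value is $1$, and Player 2 wins if its value is $0$. For $i\in\{1,2\}$ let $W_n^i\subset\{0,1\}^{2^n}$ be the set of games of depth $n$ won by Player $i$, i.e. with value $2-i$. For an integer $d\ge1$, a game $G\in W_n^i$ is $d$-fragile if the Hamming distance of $G$ from the set $W_n^{3-i}$ is at most $d$. For $p\in[0,1]$, $G_n(p)\in\{0,1\}^{2^n}$ is the random game whose leaf payoffs are i.i.d. Bernoulli, equal to $1$ with probability $p$ and $0$ with probability $1-p$. The golden game of depth $n$ is $G_n(\varphi)$, and $F_n(d)=\Pr[G_n(\varphi)\text{ is } d\text{-fragile}]$. The limit $F(d)=\lim_{n\to\infty}F_n(d)$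 exists for every $d\ge1$ (this is established separately in the paper). *)

theory Defs
  imports "HOL-Probability.Probability"
begin

text \<open>
  A game of depth \<open>n\<close> is the list of its \<open>2 ^ n\<close> leaf payoffs from left to right, with
  \<^const>\<open>True\<close> for payoff 1 and \<^const>\<open>False\<close> for payoff 0.
\<close>

definition games :: "nat \<Rightarrow> bool list set" where
  "games n = {G. length G = 2 ^ n}"

text \<open>
  The two children of the root (which has height \<open>Suc n\<close>) are the roots of the left and the right
  half of the list of leaves. On \<^typ>\<open>bool\<close> the order is \<open>False < True\<close>.
\<close>

fun game_value :: "nat \<Rightarrow> bool list \<Rightarrow> bool" where
  "game_value 0 G = hd G"
| "game_value (Suc n) G =
    (if odd (Suc n)
     then min (game_value n (take (2 ^ n) G)) (game_value n (drop (2 ^ n) G))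
     else max (game_value n (take (2 ^ n) G)) (game_value n (drop (2 ^ n) G)))"

definition won_games :: "nat \<Rightarrow> nat \<Rightarrow> bool list set" where
  "won_games n i = {G \<in> games n. of_bool (game_value n G) = 2 - i}"

definition hamming_dist :: "bool list \<Rightarrow> bool list \<Rightarrow> nat" where
  "hamming_dist G H = card {k. k < length G \<and> G ! k \<noteq> H ! k}"

definition hamming_setdist :: "bool list \<Rightarrow> bool list set \<Rightarrow> nat" where
  "hamming_setdist G A = (INF H\<in>A. hamming_dist G H)"

definition fragile :: "nat \<Rightarrow> nat \<Rightarrow> bool list \<Rightarrow> bool" where
  "fragile n d G \<longleftrightarrow>
    (\<exists>i\<in>{1, 2}. G \<in> won_games n i \<and> hamming_setdist G (won_games n (3 - i)) \<le> d)"

definition random_game :: "nat \<Rightarrow> real \<Rightarrow> bool list pmf" where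
  "random_game n p = replicate_pmf (2 ^ n) (bernoulli_pmf p)"

definition phi :: real where
  "phi = (sqrt 5 - 1) / 2"

definition fragile_prob :: "nat \<Rightarrow> nat \<Rightarrow> real" where
  "fragile_prob n d = measure_pmf.prob (random_game n phi) {G. fragile n d G}"

definition fragile_lim :: "nat \<Rightarrow> real" where
  "fragile_lim d = lim (\<lambda>n. fragile_prob n d)"

text \<open>
  The infimum in \<open>hamming_setdist\<close> is only taken over nonempty sets, and \<open>phi\<close> is a
  legitimate Bernoulli parameter (\<^const>\<open>bernoulli_pmf\<close> truncates its argument to the unit
  interval).
\<close>

lemma game_value_replicate: "game_value n (replicate (2 ^ n) b) = b"
  by (induction n) (simp_all add: mult_2)

lemma won_games_nonempty:
  assumes "i \<in> {1, 2}"
  shows "won_games n i \<noteq> {}"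
proof -
  have "replicate (2 ^ n) (i = 1) \<in> won_games n i"
    using assms by (auto simp: won_games_def games_def game_value_replicate)
  then show ?thesis by blast
qed

lemma phi_in_unit_interval: "phi \<in> {0..1}"
proof -
  have "1 \<le> sqrt 5" by simp
  moreover have "sqrt 5 \<le> 3" by (rule real_le_lsqrt) simp_all
  ultimately show ?thesis by (simp add: phi_def)
qed

end

theory Submission
  imports Defs "HOL-Probability.Product_PMF"
begin

text \<open>
  The least number of changes giving the root a prescribed value is the sum of the costs of the two
  subtrees if the player who dislikes that value moves at the root, and their minimum otherwise. For the golden game the
  cost for the player who moves at the root has the law of \<open>X\<^sub>m\<close>, where \<open>m\<close> is half the
  depth rounded down, and \<open>X\<^sub>m\<^sub>+\<^sub>1\<close> is the minimum of two independent sums of two independent copies of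
  \<open>X\<^sub>m\<close>; in a game of positive depth the cost for the opponent is a sum of two such copies. Since
  \<open>X\<^sub>0\<close> is stochastically below \<open>X\<^sub>1\<close>, the tails \<open>t m k = P (X\<^sub>m > k)\<close> increase with
  \<open>m\<close> to limits \<open>T k\<close>, and comparing tails gives \<open>T (2 k) \<le> 4 (T k)\<^sup>2\<close>. Therefore
  \<open>T\<close> tends to \<open>0\<close> or to a number that is at least \<open>1/4\<close>. The latter is excluded by \<open>T 1 \<le> 1/10\<close>,
  which the recursion at \<open>k = 1\<close> preserves because \<open>P (X\<^sub>m = 0) = \<phi>\<close> for all \<open>m\<close>.
\<close>

section \<open>Hamming distance and the cost of forcing a value\<close>

lemma hamming_dist_Cons:
  "hamming_dist (x # G) (y # H) = of_bool (x \<noteq> y) + hamming_dist G H"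
proof -
  have "{k. k < length (x # G) \<and> (x # G) ! k \<noteq> (y # H) ! k} =
      {k. k = 0 \<and> x \<noteq> y} \<union> Suc ` {k. k < length G \<and> G ! k \<noteq> H ! k}" (is "?A = ?B \<union> Suc ` ?C")
  proof (rule set_eqI)
    fix k show "k \<in> ?A \<longleftrightarrow> k \<in> ?B \<union> Suc ` ?C" by (cases k) auto
  qed
  moreover have "finite ?B" "?B \<inter> Suc ` ?C = {}" "card ?B = of_bool (x \<noteq> y)"
    by (auto simp: card_eq_0_iff)
  ultimately show ?thesis
    by (simp add: hamming_dist_def card_Un_disjoint card_image)
qed

lemma hamming_dist_append:
  "length G1 = length H1 \<Longrightarrow>
    hamming_dist (G1 @ G2) (H1 @ H2) = hamming_dist G1 H1 + hamming_dist G2 H2"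
  by (induction rule: list_induct2) (simp_all add: hamming_dist_Cons hamming_dist_def[of "[]"])

text \<open>The minimizer moves at odd heights, so \<open>odd (Suc n) = b\<close> says that the
  mover dislikes the value \<open>b\<close>. Both children must then be forced, and the costs add
  up.\<close>

fun cost :: "bool \<Rightarrow> nat \<Rightarrow> bool list \<Rightarrow> nat" where
  "cost b 0 G = of_bool (hd G \<noteq> b)"
| "cost b (Suc n) G = (if odd (Suc n) = b then (+) else min)
     (cost b n (take (2 ^ n) G)) (cost b n (drop (2 ^ n) G))"

lemma game_value_Suc_eq_iff:
  "game_value (Suc n) G = b \<longleftrightarrow>
    (if odd (Suc n) = b
     then game_value n (take (2 ^ n) G) = b \<and> game_value n (drop (2 ^ n) G) = b
     else game_value n (take (2 ^ n) G) = b \<or> game_value n (drop (2 ^ n) G) = b)"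
  by (cases b) (auto simp: min_def max_def)

text \<open>Hamming distance is additive over the two halves. The value of \<open>H\<close> makes
  both halves pay their costs, or at least one of them, which then pays no less than the
  minimum.\<close>

lemma cost_le_hamming_dist:
  assumes "length G = 2 ^ n" "length H = 2 ^ n" "game_value n H = b"
  shows "cost b n G \<le> hamming_dist G H"
  using assms
proof (induction n arbitrary: G H)
  case 0
  then obtain x y where "G = [x]" "H = [y]" by (auto simp: length_Suc_conv)
  with 0 show ?case by (simp add: hamming_dist_Cons)
next
  case (Suc n)
  define G1 G2 H1 H2 where defs: "G1 = take (2 ^ n) G" "G2 = drop (2 ^ n) G"
    "H1 = take (2 ^ n) H" "H2 = drop (2 ^ n) H"
  have len: "length G1 = 2 ^ n" "length G2 = 2 ^ n" "length H1 = 2 ^ n" "length H2 = 2 ^ n"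
    using Suc.prems by (simp_all add: defs)
  have "hamming_dist G H = hamming_dist (G1 @ G2) (H1 @ H2)" by (simp add: defs)
  also have "\<dots> = hamming_dist G1 H1 + hamming_dist G2 H2"
    by (simp add: hamming_dist_append len)
  finally have split: "hamming_dist G H = hamming_dist G1 H1 + hamming_dist G2 H2" .
  have "game_value n H1 = b \<Longrightarrow> cost b n G1 \<le> hamming_dist G1 H1"
    "game_value n H2 = b \<Longrightarrow> cost b n G2 \<le> hamming_dist G2 H2"
    using Suc.IH len by blast+
  moreover have "if odd (Suc n) = b then game_value n H1 = b \<and> game_value n H2 = b
      else game_value n H1 = b \<or> game_value n H2 = b"
    using Suc.prems(3) unfolding game_value_Suc_eq_iff defs .
  moreover have "cost b (Suc n) G = (if odd (Suc n) = b then (+) else min) (cost b n G1) (cost b n G2)"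
    by (simp add: defs)
  ultimately show ?case
    unfolding split by (auto split: if_splits)
qed

text \<open>Both halves are changed optimally if the costs add up. Otherwise only the cheaper half
  is changed and the other is kept.\<close>

lemma cost_attained:
  assumes "length G = 2 ^ n"
  shows "\<exists>H. length H = 2 ^ n \<and> game_value n H = b \<and> hamming_dist G H = cost b n G"
  using assms
proof (induction n arbitrary: G)
  case 0
  then obtain x where "G = [x]" by (auto simp: length_Suc_conv)
  then show ?case
    by (intro exI[of _ "[b]"]) (simp add: hamming_dist_Cons hamming_dist_def[of "[]"])
next
  case (Suc n)
  define G1 G2 where defs: "G1 = take (2 ^ n) G" "G2 = drop (2 ^ n) G"
  have len: "length G1 = 2 ^ n" "length G2 = 2 ^ n"
    using Suc.prems by (simp_all add: defs)
  have G: "G = G1 @ G2" by (simp add: defs)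
  obtain H1 where H1: "length H1 = 2 ^ n" "game_value n H1 = b" "hamming_dist G1 H1 = cost b n G1"
    using Suc.IH[OF len(1)] by blast
  obtain H2 where H2: "length H2 = 2 ^ n" "game_value n H2 = b" "hamming_dist G2 H2 = cost b n G2"
    using Suc.IH[OF len(2)] by blast
  have self: "hamming_dist K K = 0" for K by (simp add: hamming_dist_def)
  have cost: "cost b (Suc n) G = (if odd (Suc n) = b then (+) else min) (cost b n G1) (cost b n G2)"
    by (simp add: defs)
  consider "odd (Suc n) = b" | "odd (Suc n) \<noteq> b" "cost b n G1 \<le> cost b n G2"
    | "odd (Suc n) \<noteq> b" "cost b n G2 \<le> cost b n G1" by linarith
  then show ?case
  proof cases
    case 1
    with H1 H2 len show ?thesis
      unfolding game_value_Suc_eq_iff cost G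
      by (intro exI[of _ "H1 @ H2"]) (auto simp: hamming_dist_append)
  next
    case 2
    with H1 len show ?thesis
      unfolding game_value_Suc_eq_iff cost G
      by (intro exI[of _ "H1 @ G2"]) (auto simp: hamming_dist_append self)
  next
    case 3
    with H2 len show ?thesis
      unfolding game_value_Suc_eq_iff cost G
      by (intro exI[of _ "G1 @ H2"]) (auto simp: hamming_dist_append self)
  qed
qed

lemma hamming_setdist_eq_cost:
  assumes "length G = 2 ^ n"
  shows "hamming_setdist G {H. length H = 2 ^ n \<and> game_value n H = b} = cost b n G"
  unfolding hamming_setdist_def
proof (rule cInf_eq_minimum)
  show "cost b n G \<in> hamming_dist G ` {H. length H = 2 ^ n \<and> game_value n H = b}"
    using cost_attained[OF assms, of b] by (auto simp: image_iff)
  show "cost b n G \<le> x" if "x \<in> hamming_dist G ` {H. length H = 2 ^ n \<and> game_value n H = b}" for x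
    using that cost_le_hamming_dist assms by auto
qed

lemma won_games_eq:
  "won_games n 1 = {G. length G = 2 ^ n \<and> game_value n G = True}"
  "won_games n 2 = {G. length G = 2 ^ n \<and> game_value n G = False}"
  "won_games n (Suc 0) = {G. length G = 2 ^ n \<and> game_value n G = True}"
  by (auto simp: won_games_def games_def)

lemma cost_eq_0_iff:
  assumes "length G = 2 ^ n"
  shows "cost b n G = 0 \<longleftrightarrow> game_value n G = b"
  using assms
proof (induction n arbitrary: G)
  case (Suc n)
  then have "length (take (2 ^ n) G) = 2 ^ n" "length (drop (2 ^ n) G) = 2 ^ n" by simp_all
  note IH = this[THEN Suc.IH]
  show ?case
    unfolding game_value_Suc_eq_iff cost.simps using IH by (auto simp: min_def)
qed simp

text \<open>The winner's cost is 0, so one of the two bounds is trivial and the other is the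
  distance to the games won by the loser.\<close>

lemma fragile_iff_cost_le:
  assumes "length G = 2 ^ n"
  shows "fragile n d G \<longleftrightarrow> cost True n G \<le> d \<and> cost False n G \<le> d"
proof -
  have "game_value n G \<Longrightarrow> cost True n G = 0" "\<not> game_value n G \<Longrightarrow> cost False n G = 0"
    using cost_eq_0_iff[OF assms] by auto
  then show ?thesis
    unfolding fragile_def
    using hamming_setdist_eq_cost[OF assms, of True] hamming_setdist_eq_cost[OF assms, of False]
    by (cases "game_value n G") (simp_all add: won_games_eq assms)
qed

subsection \<open>Laws of the costs\<close>

definition tail :: "nat pmf \<Rightarrow> nat \<Rightarrow> real" where
  "tail P k = measure_pmf.prob P {k<..}"

definition combine_pmf :: "('a \<Rightarrow> 'a \<Rightarrow> 'a) \<Rightarrow> 'a pmf \<Rightarrow> 'a pmf" where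
  "combine_pmf f P = map_pmf (\<lambda>(x, y). f x y) (pair_pmf P P)"

definition cost_law :: "bool \<Rightarrow> nat \<Rightarrow> nat pmf" where
  "cost_law b n = map_pmf (cost b n) (random_game n phi)"

lemma length_random_game: "G \<in> set_pmf (random_game n p) \<Longrightarrow> length G = 2 ^ n"
  by (simp add: random_game_def set_replicate_pmf)

lemma random_game_Suc:
  "random_game (Suc n) p =
    map_pmf (\<lambda>(G, H). G @ H) (pair_pmf (random_game n p) (random_game n p))"
  by (simp add: random_game_def mult_2 replicate_pmf_distrib map_pmf_def pair_pmf_def
      bind_assoc_pmf bind_return_pmf)

text \<open>The two halves of a random game are independent random games, so their costs are
  independent copies.\<close>

lemma cost_law_Suc:
  "cost_law b (Suc n) = combine_pmf (if odd (Suc n) = b then (+) else min) (cost_law b n)"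
proof -
  let ?f = "if odd (Suc n) = b then (+) else min :: nat \<Rightarrow> nat \<Rightarrow> nat"
  let ?R = "random_game n phi"
  have "cost_law b (Suc n) = map_pmf (\<lambda>(G, H). cost b (Suc n) (G @ H)) (pair_pmf ?R ?R)"
    unfolding cost_law_def random_game_Suc map_pmf_comp by (simp add: case_prod_unfold)
  also have "\<dots> = map_pmf (\<lambda>(G, H). ?f (cost b n G) (cost b n H)) (pair_pmf ?R ?R)"
    by (rule map_pmf_cong) (auto simp: length_random_game)
  also have "\<dots> = combine_pmf ?f (cost_law b n)"
    by (simp add: combine_pmf_def cost_law_def map_pair[symmetric] map_pmf_comp case_prod_unfold)
  finally show ?thesis .
qed

section \<open>Tails of minima and sums of independent copies\<close>

lemma prob_pair_Times:
  "measure_pmf.prob (pair_pmf P Q) (A \<times> B) = measure_pmf.prob P A * measure_pmf.prob Q B"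
  for A :: "'a::countable set" and B :: "'b::countable set"
  by (rule measure_pmf_prob_product) simp_all

lemma tail_min: "tail (combine_pmf min P) k = (tail P k)\<^sup>2"
proof -
  have "(\<lambda>(x, y). min x y) -` {k<..} = {k<..} \<times> {k<..}" by auto
  then show ?thesis
    by (simp add: tail_def combine_pmf_def prob_pair_Times power2_eq_square)
qed

lemma tail_nonneg: "0 \<le> tail P k"
  by (simp add: tail_def)

lemma tail_le_1: "tail P k \<le> 1"
  by (simp add: tail_def)

lemma tail_antimono: "i \<le> k \<Longrightarrow> tail P k \<le> tail P i"
  unfolding tail_def by (rule measure_pmf.finite_measure_mono) auto

lemma prob_0: "measure_pmf.prob P {0} = 1 - tail P 0"
proof -
  have "{0<..} = UNIV - {0::nat}" by auto
  then show ?thesis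
    using measure_pmf.prob_compl[of "{0}" P] by (simp add: tail_def)
qed

lemma tail_sum_0: "tail (combine_pmf (+) P) 0 = 1 - (1 - tail P 0)\<^sup>2"
proof -
  have "(\<lambda>(x, y). x + y) -` {0<..} = UNIV - {0::nat} \<times> {0}" by auto
  then have "tail (combine_pmf (+) P) 0 = 1 - measure_pmf.prob (pair_pmf P P) ({0} \<times> {0})"
    using measure_pmf.prob_compl[of "{0} \<times> {0}" "pair_pmf P P"]
    by (simp add: tail_def combine_pmf_def)
  then show ?thesis by (simp only: prob_pair_Times prob_0 power2_eq_square)
qed

text \<open>A sum exceeds 1 only if both summands are positive, or one is 0 and the other exceeds
  1.\<close>

lemma tail_sum_1: "tail (combine_pmf (+) P) 1 \<le> (tail P 0)\<^sup>2 + 2 * (1 - tail P 0) * tail P 1"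
proof -
  let ?p = "measure_pmf.prob (pair_pmf P P)"
  let ?A = "{0<..} \<times> {0<..} :: (nat \<times> nat) set" and ?B = "{0} \<times> {1<..} :: (nat \<times> nat) set"
    and ?C = "{1<..} \<times> {0} :: (nat \<times> nat) set"
  have "tail (combine_pmf (+) P) 1 = ?p ((\<lambda>(x, y). x + y) -` {1<..})"
    by (simp add: tail_def combine_pmf_def)
  also have "\<dots> \<le> ?p (?A \<union> ?B \<union> ?C)"
    by (rule measure_pmf.finite_measure_mono) auto
  also have "\<dots> \<le> ?p (?A \<union> ?B) + ?p ?C"
    by (rule measure_Un_le) auto
  also have "?p (?A \<union> ?B) \<le> ?p ?A + ?p ?B"
    by (rule measure_Un_le) auto
  also have "?p ?A = (tail P 0)\<^sup>2"
    unfolding prob_pair_Times by (simp add: tail_def power2_eq_square)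
  also have "?p ?B = (1 - tail P 0) * tail P 1"
    unfolding prob_pair_Times prob_0 tail_def ..
  also have "?p ?C = tail P 1 * (1 - tail P 0)"
    unfolding prob_pair_Times prob_0 tail_def ..
  finally show ?thesis by (simp add: algebra_simps)
qed

text \<open>If a sum exceeds \<open>2 * k\<close>, then one summand exceeds
  \<open>k\<close>.\<close>

lemma tail_sum_double: "tail (combine_pmf (+) P) (2 * k) \<le> 2 * tail P k"
proof -
  let ?p = "measure_pmf.prob (pair_pmf P P)"
  have "tail (combine_pmf (+) P) (2 * k) = ?p ((\<lambda>(x, y). x + y) -` {2 * k<..})"
    by (simp add: tail_def combine_pmf_def)
  also have "\<dots> \<le> ?p ({k<..} \<times> UNIV \<union> UNIV \<times> {k<..})"
    by (rule measure_pmf.finite_measure_mono) auto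
  also have "\<dots> \<le> ?p ({k<..} \<times> UNIV) + ?p (UNIV \<times> {k<..})"
    by (rule measure_Un_le) auto
  also have "\<dots> = 2 * tail P k"
    by (simp only: prob_pair_Times) (simp add: tail_def)
  finally show ?thesis .
qed

text \<open>Conditioning on the first summand turns each side into an average of tails of the
  second.\<close>

lemma prob_add_gt_mono:
  fixes P Q Q' :: "nat pmf"
  assumes "\<And>k. tail Q k \<le> tail Q' k"
  shows "measure_pmf.prob (pair_pmf P Q) {(x, y). k < x + y}
    \<le> measure_pmf.prob (pair_pmf P Q') {(x, y). k < x + y}"
proof -
  have eq: "emeasure (pair_pmf P R) {(x, y). k < x + y} =
      (\<integral>\<^sup>+x. emeasure (measure_pmf R) {y. k < x + y} \<partial>measure_pmf P)" for R
  proof -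
    have "pair_pmf P R = bind_pmf P (\<lambda>x. map_pmf (Pair x) R)"
      by (simp add: pair_pmf_def map_pmf_def)
    then show ?thesis by (simp add: vimage_def)
  qed
  have "measure_pmf.prob Q {y. k < x + y} \<le> measure_pmf.prob Q' {y. k < x + y}" for x
  \<comment> \<open>For \<open>k < x\<close> the truncated difference \<open>k - x\<close> is 0, and
    the set \<open>{k - x<..}\<close> would lose \<open>y = 0\<close>.\<close>
  proof (cases "k < x")
    case True
    then have "{y. k < x + y} = UNIV" by auto
    then show ?thesis by simp
  next
    case False
    then have "{y. k < x + y} = {k - x<..}" by auto
    then show ?thesis using assms by (simp add: tail_def)
  qed
  then have "emeasure (pair_pmf P Q) {(x, y). k < x + y} \<le> emeasure (pair_pmf P Q') {(x, y). k < x + y}"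
    unfolding eq by (intro nn_integral_mono) (simp add: measure_pmf.emeasure_eq_measure)
  then show ?thesis by (simp add: measure_pmf.emeasure_eq_measure)
qed

lemma prob_add_gt_commute:
  fixes P Q :: "nat pmf"
  shows "measure_pmf.prob (pair_pmf P Q) {(x, y). k < x + y} =
    measure_pmf.prob (pair_pmf Q P) {(x, y). k < x + y}"
  by (subst pair_commute_pmf) (simp add: vimage_def case_prod_unfold add.commute)

text \<open>The summands are replaced one at a time, passing from (P, P) through (P, Q) and (Q, P)
  to (Q, Q).\<close>

lemma tail_sum_mono:
  assumes "\<And>k. tail P k \<le> tail Q k"
  shows "tail (combine_pmf (+) P) k \<le> tail (combine_pmf (+) Q) k"
proof -
  have eq: "tail (combine_pmf (+) R) k = measure_pmf.prob (pair_pmf R R) {(x, y). k < x + y}" for R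
    by (simp add: tail_def combine_pmf_def vimage_def case_prod_unfold)
  have "tail (combine_pmf (+) P) k \<le> measure_pmf.prob (pair_pmf P Q) {(x, y). k < x + y}"
    unfolding eq using assms by (rule prob_add_gt_mono)
  also have "\<dots> = measure_pmf.prob (pair_pmf Q P) {(x, y). k < x + y}"
    by (rule prob_add_gt_commute)
  also have "\<dots> \<le> tail (combine_pmf (+) Q) k"
    unfolding eq using assms by (rule prob_add_gt_mono)
  finally show ?thesis .
qed

subsection \<open>The golden game\<close>

lemma phi_bounds: "0.618 \<le> phi" "phi \<le> 0.6181"
proof -
  have "2.236 \<le> sqrt 5" by (rule real_le_rsqrt) (simp add: power2_eq_square)
  moreover have "sqrt 5 \<le> 2.2362" by (rule real_le_lsqrt) (simp_all add: power2_eq_square)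
  ultimately show "0.618 \<le> phi" "phi \<le> 0.6181" by (simp_all add: phi_def)
qed

lemma phi_squared: "phi\<^sup>2 = 1 - phi"
  by (simp add: phi_def power2_eq_square field_simps)

text \<open>
  At every even height Player 1 moves and at every odd height Player 2, so the cost of forcing a
  win for the player who moves at the root is a minimum over the two subtrees, and the cost for
  the opponent is a sum.
\<close>

definition min_law :: "nat \<Rightarrow> nat pmf" where
  "min_law n = cost_law (even n) n"

definition sum_law :: "nat \<Rightarrow> nat pmf" where
  "sum_law n = cost_law (odd n) n"

lemma min_law_Suc: "min_law (Suc n) = combine_pmf min (sum_law n)"
  by (simp add: min_law_def sum_law_def cost_law_Suc)

lemma sum_law_Suc: "sum_law (Suc n) = combine_pmf (+) (min_law n)"
  by (simp add: min_law_def sum_law_def cost_law_Suc)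

text \<open>Height 0 counts as even: \<open>min_law 0\<close> is the cost of making the single leaf
  1, and \<open>sum_law 0\<close> that of making it 0.\<close>

lemma tail_law_0:
  "tail (min_law 0) k = (if k = 0 then 1 - phi else 0)"
  "tail (sum_law 0) k = (if k = 0 then phi else 0)"
proof -
  have law: "cost_law b 0 = map_pmf (\<lambda>x. of_bool (x \<noteq> b)) (bernoulli_pmf phi)" for b
    by (simp add: cost_law_def random_game_def map_pmf_def bind_assoc_pmf bind_return_pmf)
  have vimage: "(\<lambda>x. of_bool (x \<noteq> b)) -` {k<..} = (if k = 0 then {\<not> b} else {})" for b
    by (auto simp: of_bool_def split: if_splits)
  have "tail (cost_law b 0) k = (if k = 0 then pmf (bernoulli_pmf phi) (\<not> b) else 0)" for b
    unfolding law tail_def measure_map_pmf vimage by (simp add: measure_pmf_single)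
  then show "tail (min_law 0) k = (if k = 0 then 1 - phi else 0)"
    "tail (sum_law 0) k = (if k = 0 then phi else 0)"
    using phi_bounds by (simp_all add: min_law_def sum_law_def)
qed

section \<open>Recursion, monotonicity and bounds of the tails\<close>

lemma tail_min_law_Suc: "tail (min_law (Suc n)) k = (tail (sum_law n) k)\<^sup>2"
  by (simp add: min_law_Suc tail_min)

lemma tail_min_law_1: "tail (min_law (Suc 0)) k = tail (min_law 0) k"
  by (simp add: tail_min_law_Suc tail_law_0 phi_squared)

text \<open>The identity \<open>phi\<^sup>2 = 1 - phi\<close> makes these two values a fixed point
  of the recursion: the root mover wins with probability \<open>phi\<close> at every depth.\<close>

lemma tail_laws_at_0: "tail (min_law n) 0 = 1 - phi \<and> tail (sum_law n) 0 = phi"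
proof (induction n)
  case (Suc n)
  then show ?case
    by (simp add: min_law_Suc sum_law_Suc tail_min tail_sum_0 phi_squared)
qed (simp add: tail_law_0)

text \<open>Two levels of the tree act monotonically on tails, so the induction goes down in steps
  of two and has two base cases.\<close>

lemma tail_min_law_le_Suc: "tail (min_law n) k \<le> tail (min_law (Suc n)) k"
proof (induction n arbitrary: k rule: less_induct)
  case (less n)
  consider "n = 0" | "n = Suc 0" | m where "n = Suc (Suc m)"
    by (cases n rule: nat.exhaust; metis nat.exhaust)
  then show ?case
  proof cases
    case 1
    then show ?thesis by (simp add: tail_min_law_1)
  next
    \<comment> \<open>At depth 1 the cost is at most 1. The tails at \<open>k = 0\<close> agree at
      all depths, and for \<open>k > 0\<close> the left side is 0.\<close>
    case 2
    then show ?thesis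
      using tail_laws_at_0[of "Suc (Suc 0)"] tail_nonneg
      by (simp add: tail_min_law_1 tail_law_0)
  next
    case 3
    then have "tail (sum_law (Suc m)) k \<le> tail (sum_law (Suc (Suc m))) k"
      unfolding sum_law_Suc using less.IH[of m] by (intro tail_sum_mono) simp
    then show ?thesis
      unfolding 3 tail_min_law_Suc by (rule power_mono) (rule tail_nonneg)
  qed
qed

text \<open>Two levels take a tail \<open>t\<close> at 1 to at most the square of
  \<open>(1 - phi)\<^sup>2 + 2 * phi * t\<close>, and this preserves
  \<open>t \<le> 1 / 10\<close>.\<close>

lemma tail_min_law_at_1_le: "tail (min_law n) 1 \<le> 1 / 10"
proof (induction n rule: less_induct)
  case (less n)
  consider "n = 0" | "n = Suc 0" | m where "n = Suc (Suc m)"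
    by (cases n rule: nat.exhaust; metis nat.exhaust)
  then show ?case
  proof cases
    case 3
    then have IH: "tail (min_law m) 1 \<le> 1 / 10" using less by simp
    have "tail (sum_law (Suc m)) 1 \<le> (1 - phi)\<^sup>2 + 2 * phi * tail (min_law m) 1"
      using tail_sum_1[of "min_law m"] tail_laws_at_0[of m] by (simp add: sum_law_Suc)
    \<comment> \<open>Here 0.382 = 1 - 0.618 bounds \<open>1 - phi\<close> from above. The sum is
      about 0.27.\<close>
    also have "\<dots> \<le> 0.382\<^sup>2 + 2 * 0.6181 * (1 / 10)"
      using phi_bounds IH tail_nonneg by (intro add_mono power_mono mult_mono) auto
    also have "\<dots> \<le> 0.3" by (simp add: power2_eq_square)
    finally have "(tail (sum_law (Suc m)) 1)\<^sup>2 \<le> 0.3\<^sup>2"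
      by (rule power_mono) (rule tail_nonneg)
    also have "\<dots> \<le> (1 / 10 :: real)" by (simp add: power2_eq_square)
    finally show ?thesis by (simp add: 3 tail_min_law_Suc)
  qed (simp_all add: tail_law_0 tail_min_law_Suc)
qed

lemma tail_min_law_double: "tail (min_law (Suc (Suc n))) (2 * k) \<le> 4 * (tail (min_law n) k)\<^sup>2"
proof -
  have "(tail (sum_law (Suc n)) (2 * k))\<^sup>2 \<le> (2 * tail (min_law n) k)\<^sup>2"
    unfolding sum_law_Suc by (rule power_mono) (rule tail_sum_double tail_nonneg)+
  then show ?thesis by (simp add: tail_min_law_Suc power_mult_distrib)
qed

section \<open>Limits of the tails\<close>

definition lim_tail :: "nat \<Rightarrow> real" where
  "lim_tail k = lim (\<lambda>n. tail (min_law n) k)"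

lemma tendsto_tail_min_law: "(\<lambda>n. tail (min_law n) k) \<longlonglongrightarrow> lim_tail k"
proof -
  have "incseq (\<lambda>n. tail (min_law n) k)"
    by (rule incseq_SucI) (rule tail_min_law_le_Suc)
  then have "convergent (\<lambda>n. tail (min_law n) k)"
    using tail_le_1 incseq_convergent unfolding convergent_def by blast
  then show ?thesis by (simp add: lim_tail_def convergent_LIMSEQ_iff)
qed

text \<open>The tail of \<open>sum_law n\<close> is the square root of the tail of
  \<open>min_law (Suc n)\<close>.\<close>

lemma tendsto_tail_sum_law: "(\<lambda>n. tail (sum_law n) k) \<longlonglongrightarrow> sqrt (lim_tail k)"
proof -
  have "tail (sum_law n) k = sqrt (tail (min_law (Suc n)) k)" for n
    by (simp add: tail_min_law_Suc tail_nonneg)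
  then show ?thesis
    using tendsto_real_sqrt[OF LIMSEQ_Suc[OF tendsto_tail_min_law]] by simp
qed

lemma lim_tail_nonneg: "0 \<le> lim_tail k"
  by (rule LIMSEQ_le_const[OF tendsto_tail_min_law]) (auto intro: tail_nonneg)

lemma lim_tail_antimono: "i \<le> k \<Longrightarrow> lim_tail k \<le> lim_tail i"
  by (rule LIMSEQ_le[OF tendsto_tail_min_law tendsto_tail_min_law]) (auto intro: tail_antimono)

lemma lim_tail_1: "lim_tail 1 \<le> 1 / 10"
  by (rule LIMSEQ_le_const2[OF tendsto_tail_min_law]) (use tail_min_law_at_1_le in auto)

lemma lim_tail_double: "lim_tail (2 * k) \<le> 4 * (lim_tail k)\<^sup>2"
proof (rule LIMSEQ_le)
  show "(\<lambda>n. tail (min_law (Suc (Suc n))) (2 * k)) \<longlonglongrightarrow> lim_tail (2 * k)"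
    by (intro LIMSEQ_Suc tendsto_tail_min_law)
  show "(\<lambda>n. 4 * (tail (min_law n) k)\<^sup>2) \<longlonglongrightarrow> 4 * (lim_tail k)\<^sup>2"
    by (intro tendsto_intros tendsto_tail_min_law)
qed (auto intro: tail_min_law_double)

lemma lim_tail_tendsto_0: "lim_tail \<longlonglongrightarrow> 0"
proof -
  have "decseq lim_tail" by (simp add: decseq_def lim_tail_antimono)
  then obtain L where L: "lim_tail \<longlonglongrightarrow> L"
    using decseq_convergent[of lim_tail 0] lim_tail_nonneg by metis
  have "strict_mono (\<lambda>k. 2 * k :: nat)" by (simp add: strict_mono_def)
  from LIMSEQ_subseq_LIMSEQ[OF L this] have "(\<lambda>k. lim_tail (2 * k)) \<longlonglongrightarrow> L"
    by (simp add: comp_def)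
  moreover have "(\<lambda>k. 4 * (lim_tail k)\<^sup>2) \<longlonglongrightarrow> 4 * L\<^sup>2"
    by (intro tendsto_intros L)
  ultimately have "L \<le> 4 * L\<^sup>2"
    by (rule LIMSEQ_le) (auto intro: lim_tail_double)
  have "0 \<le> L" using L by (rule LIMSEQ_le_const) (auto intro: lim_tail_nonneg)
  have "lim_tail k \<le> 1 / 10" if "1 \<le> k" for k
    using lim_tail_antimono[OF that] lim_tail_1 by linarith
  then have "L \<le> 1 / 10" using L by (intro LIMSEQ_le_const2) auto
  \<comment> \<open>Together with \<open>L \<le> 4 * L\<^sup>2\<close> this gives
    \<open>L \<le> 4 / 10 * L\<close>, which forces \<open>L = 0\<close>.\<close>
  have "L * L \<le> 1 / 10 * L" using \<open>0 \<le> L\<close> \<open>L \<le> 1 / 10\<close> by (rule mult_right_mono[rotated])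
  with \<open>L \<le> 4 * L\<^sup>2\<close> \<open>0 \<le> L\<close> have "L = 0" by (simp add: power2_eq_square)
  with L show ?thesis by simp
qed

section \<open>Probability of fragility\<close>

text \<open>A game is not fragile if one of its two costs exceeds \<open>d\<close>. These two events
  are disjoint, since one cost is always 0.\<close>

lemma fragile_prob_eq: "fragile_prob n d = 1 - tail (min_law n) d - tail (sum_law n) d"
proof -
  let ?R = "random_game n phi"
  let ?S = "set_pmf ?R"
  let ?p = "measure_pmf.prob ?R"
  \<comment> \<open>The events are cut down to the support, where every list has length
    \<open>2 ^ n\<close> and the facts about costs apply.\<close>
  define C where "C b = {G \<in> ?S. d < cost b n G}" for b
  define F where "F = {G \<in> ?S. fragile n d G}"
  have frag: "fragile n d G \<longleftrightarrow> cost True n G \<le> d \<and> cost False n G \<le> d"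
    and zero: "cost True n G = 0 \<or> cost False n G = 0" if "G \<in> ?S" for G
    using that length_random_game fragile_iff_cost_le cost_eq_0_iff by metis+
  have C: "?p (C b) = tail (cost_law b n) d" for b
  proof -
    have "C b = {G. d < cost b n G} \<inter> ?S" by (auto simp: C_def)
    then show ?thesis
      by (simp add: measure_Int_set_pmf tail_def cost_law_def vimage_def)
  qed
  have F: "?p F = fragile_prob n d"
  proof -
    have "F = {G. fragile n d G} \<inter> ?S" by (auto simp: F_def)
    then show ?thesis by (simp add: measure_Int_set_pmf fragile_prob_def)
  qed
  have "1 = ?p ?S" using measure_Int_set_pmf[of ?R UNIV] by simp
  also have "?S = F \<union> (C True \<union> C False)"
    using frag by (auto simp: F_def C_def not_le)
  also have "?p \<dots> = ?p F + ?p (C True \<union> C False)"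
    by (rule measure_pmf.finite_measure_Union) (use frag in \<open>auto simp: F_def C_def\<close>)
  also have "?p (C True \<union> C False) = ?p (C True) + ?p (C False)"
    by (rule measure_pmf.finite_measure_Union) (use zero in \<open>fastforce simp: C_def\<close>)+
  finally show ?thesis
    by (cases "even n") (simp_all add: C F min_law_def sum_law_def)
qed

lemma fragile_lim_eq: "fragile_lim d = 1 - lim_tail d - sqrt (lim_tail d)"
  unfolding fragile_lim_def fragile_prob_eq
  by (intro limI tendsto_intros tendsto_tail_min_law tendsto_tail_sum_law)

theorem proposition7:
  shows "fragile_lim \<longlonglongrightarrow> 1"
proof -
  have "(\<lambda>d. 1 - lim_tail d - sqrt (lim_tail d)) \<longlonglongrightarrow> 1 - 0 - sqrt 0"
    by (intro tendsto_intros lim_tail_tendsto_0)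
  then show ?thesis by (simp add: fragile_lim_eq[abs_def])
qed

end
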